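(* Let $((s_j,t_j):-\infty<j<\infty)$ be a stationary ergodic sequence of pairs of positive random variables, and suppose that the random variable $$\widetilde X_\infty=\max\Big(0,\ \sup_{j\ge 1}\Big[s_{-j}-\sum_{k=1}^{j-1}t_{-k}\Big]\Big)$$ is finite-valued (almost surely). For $j\in\mathbb Z$ put $$X_j^*=\sup_{k\ge 0}\Big[s_{j-k}-\sum_{\ell=j-k+1}^{j}t_\ell\Big].$$ Then: a) $((s_j,t_j,X_j^* ):-\infty<j<\infty)$ is a stationary sequence, and $(X_j^*:-\infty<j<\infty)$ satisfies $$X_{j+1}^*=\max(X_j^*-t_{j+1},\,s_{j+1}),\qquad j\in\mathbb Z,$$ so that it is a stationary solution of this recursion. b) If $(X_j':-\infty<j<\infty)$ is a stationary solution of the recursion $X_{j+1}=\max(X_j-t_{j+1},s_{j+1})$, $j\in\mathbb Z$, then $X_j'=X_j^*$ almost surely for every $j\in\mathbb Z$.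
   Context: Empty sums are $0$. All random variables are defined on one probability space. The recursion $X_{n+1}=\max(X_n-t_{n+1},s_{n+1})$ is that of the maximum dater (time to drain all current work, seen just after the $n$-th arrival) in an infinite server queue with service times $s_n$ and inter-arrival times $t_n$. A stationary solution of the recursion is a stationary two-sided sequence of finite (real-valued) random variables $(X_j':j\in\mathbb Z)$, on the same probability space as the input sequence $((s_j,t_j))$, satisfying $X'_{j+1}=\max(X'_j-t_{j+1},s_{j+1})$ for all $j\in\mathbb Z$. *)

theory Defs
  imports "HOL-Probability.Probability"
begin

definition stationary_sequence ::
  "'a measure \<Rightarrow> 'b measure \<Rightarrow> (int \<Rightarrow> 'a \<Rightarrow> 'b) \<Rightarrow> bool" where
  "stationary_sequence M N Y \<longleftrightarrow>
     (\<forall>j. Y j \<in> measurable M N) \<and>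
     (\<forall>m. distr M (Pi\<^sub>M UNIV (\<lambda>_. N)) (\<lambda>\<omega> j. Y (j + m) \<omega>) =
          distr M (Pi\<^sub>M UNIV (\<lambda>_. N)) (\<lambda>\<omega> j. Y j \<omega>))"

definition stationary_ergodic_sequence ::
  "'a measure \<Rightarrow> 'b measure \<Rightarrow> (int \<Rightarrow> 'a \<Rightarrow> 'b) \<Rightarrow> bool" where
  "stationary_ergodic_sequence M N Y \<longleftrightarrow>
     stationary_sequence M N Y \<and>
     (\<forall>A \<in> sets (Pi\<^sub>M UNIV (\<lambda>_. N)).
        (\<lambda>x j. x (j + 1)) -` A \<inter> space (Pi\<^sub>M UNIV (\<lambda>_. N)) = A \<longrightarrow>
        measure M {\<omega> \<in> space M. (\<lambda>j. Y j \<omega>) \<in> A} \<in> {0, 1})"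

text \<open>The two suprema below may be infinite on a null set, so they are taken in the extended
  reals.\<close>

definition X_tilde_inf ::
  "(int \<Rightarrow> 'a \<Rightarrow> real) \<Rightarrow> (int \<Rightarrow> 'a \<Rightarrow> real) \<Rightarrow> 'a \<Rightarrow> ereal" where
  "X_tilde_inf s t \<omega> =
     max 0 (SUP j\<in>{1::nat..}. ereal (s (- int j) \<omega> - (\<Sum>k = 1..j - 1. t (- int k) \<omega>)))"

definition X_star ::
  "(int \<Rightarrow> 'a \<Rightarrow> real) \<Rightarrow> (int \<Rightarrow> 'a \<Rightarrow> real) \<Rightarrow> int \<Rightarrow> 'a \<Rightarrow> ereal" where
  "X_star s t j \<omega> =
     (SUP k::nat. ereal (s (j - int k) \<omega> - (\<Sum>l = j - int k + 1..j. t l \<omega>)))"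

text \<open>A finite random variable is an extended-real one that is finite almost surely; this covers
  real-valued sequences via the embedding \<^const>\<open>ereal\<close> as well as \<^const>\<open>X_star\<close>.
  Only \<open>X\<close> itself, not the joint sequence with \<open>(s, t)\<close>, is required to be stationary.\<close>

definition stationary_solution ::
  "'a measure \<Rightarrow> (int \<Rightarrow> 'a \<Rightarrow> real) \<Rightarrow> (int \<Rightarrow> 'a \<Rightarrow> real) \<Rightarrow> (int \<Rightarrow> 'a \<Rightarrow> ereal) \<Rightarrow> bool" where
  "stationary_solution M s t X \<longleftrightarrow>
     stationary_sequence M borel X \<and>
     (\<forall>j. AE \<omega> in M. \<bar>X j \<omega>\<bar> \<noteq> \<infinity>) \<and>
     (\<forall>j. AE \<omega> in M. X (j + 1) \<omega> = max (X j \<omega> - ereal (t (j + 1) \<omega>)) (ereal (s (j + 1) \<omega>)))"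

end

theory Submission
  imports Defs
begin

text \<open>Every solution dominates \<open>X_star\<close>, and wherever it is strictly larger the recursion never uses
  the term \<open>s\<close> in the past, so that \<open>X' (j - k) = X' j + t j + \<dots> + t (j - k + 1)\<close> for all \<open>k\<close>.
  Identically distributed finite random variables almost surely do not tend to infinity. Applied to
  \<open>1 / t (j - k)\<close> this shows that the sum of the \<open>t\<close> diverges; applied to \<open>X' (j - k)\<close> it then shows
  that strict domination has probability zero.\<close>

section \<open>Stationary sequences\<close>

lemma stationary_sequence_measurable:
  assumes "stationary_sequence M N Y"
  shows "Y j \<in> measurable M N"
  using assms by (simp add: stationary_sequence_def)

text \<open>Each marginal is the image, under the coordinate at \<open>0\<close>, of the law of a
  shifted sequence, and these laws all agree.\<close>

lemma stationary_sequence_distr_eq: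
  assumes "stationary_sequence M N Y"
  shows "distr M N (Y i) = distr M N (Y j)"
proof -
  let ?P = "Pi\<^sub>M UNIV (\<lambda>_. N) :: (int \<Rightarrow> 'b) measure"
  have Y_meas[measurable]: "\<And>i. Y i \<in> measurable M N"
    using assms by (rule stationary_sequence_measurable)
  have shift: "(\<lambda>\<omega> l. Y (l + m) \<omega>) \<in> measurable M ?P" for m
    by (rule measurable_PiM_single') (auto intro: measurable_space[OF Y_meas])
  have "distr M N (Y i) = distr (distr M ?P (\<lambda>\<omega> l. Y (l + i) \<omega>)) N (\<lambda>y. y 0)" for i
    by (subst distr_distr[OF _ shift]) (auto simp: comp_def)
  then show ?thesis
    using assms by (simp add: stationary_sequence_def)
qed

text \<open>One map \<open>?F\<close> carries the law of any shift of \<open>Y\<close> to the law of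
  the same shift of the new sequence, so equal laws stay equal.\<close>

lemma stationary_sequence_factor:
  assumes Y: "stationary_sequence M N Y"
    and \<Psi>[measurable]: "\<Psi> \<in> measurable (Pi\<^sub>M UNIV (\<lambda>_. N)) N'"
  shows "stationary_sequence M N' (\<lambda>j \<omega>. \<Psi> (\<lambda>i. Y (i + j) \<omega>))"
proof -
  let ?P = "Pi\<^sub>M UNIV (\<lambda>_. N) :: (int \<Rightarrow> 'b) measure"
  let ?P' = "Pi\<^sub>M UNIV (\<lambda>_. N') :: (int \<Rightarrow> 'c) measure"
  let ?F = "\<lambda>y j. \<Psi> (\<lambda>i. y (i + j))"
  have Y_meas[measurable]: "\<And>i. Y i \<in> measurable M N"
    using Y by (rule stationary_sequence_measurable)
  have shift: "(\<lambda>\<omega> l. Y (l + m) \<omega>) \<in> measurable M ?P" for m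
    by (rule measurable_PiM_single') (auto intro: measurable_space[OF Y_meas])
  have shift': "(\<lambda>y l. y (l + m)) \<in> measurable ?P ?P" for m
    by (rule measurable_PiM_single') (auto simp: space_PiM)
  have comp: "(\<lambda>y. \<Psi> (\<lambda>i. y (i + j))) \<in> measurable ?P N'" for j
    by (rule measurable_compose[OF shift' \<Psi>])
  have F: "?F \<in> measurable ?P ?P'"
    by (rule measurable_PiM_single') (use comp measurable_space[OF comp] in auto)
  have "distr M ?P' (\<lambda>\<omega> j. \<Psi> (\<lambda>i. Y (i + (j + m)) \<omega>)) =
        distr (distr M ?P (\<lambda>\<omega> l. Y (l + m) \<omega>)) ?P' ?F" for m
    by (subst distr_distr[OF F shift]) (simp add: comp_def add.assoc)
  from this[of 0] this show ?thesis
    using Y measurable_compose[OF shift \<Psi>] unfolding stationary_sequence_def by simp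
qed

text \<open>Divergence means that for every \<open>K\<close> the \<open>Z n\<close> eventually stay
  above \<open>K\<close>. This event \<open>B K\<close> has probability at most the tail
  \<open>p K\<close> of the common law, which vanishes as \<open>K\<close> grows. Only marginal laws
  enter.\<close>

lemma (in prob_space) AE_not_tendsto_PInfty:
  fixes Z :: "nat \<Rightarrow> 'a \<Rightarrow> ereal"
  assumes Z[measurable]: "\<And>n. Z n \<in> borel_measurable M"
    and id: "\<And>n. distr M borel (Z n) = distr M borel (Z 0)"
    and fin: "AE \<omega> in M. Z 0 \<omega> \<noteq> \<infinity>"
  shows "AE \<omega> in M. \<not> (\<lambda>n. Z n \<omega>) \<longlonglongrightarrow> \<infinity>"
proof -
  define p where "p K = prob {\<omega> \<in> space M. ereal (real K) < Z 0 \<omega>}" for K :: nat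
  define B where "B K = (\<Union>n. {\<omega> \<in> space M. \<forall>k\<ge>n. ereal (real K) < Z k \<omega>})" for K :: nat
  have [measurable]: "B K \<in> sets M" for K
    unfolding B_def by measurable
  have marginal: "prob {\<omega> \<in> space M. ereal (real K) < Z n \<omega>} = p K" for n K
  proof -
    have "prob {\<omega> \<in> space M. ereal (real K) < Z n \<omega>} =
          measure (distr M borel (Z n)) {ereal (real K)<..}" for n
      by (subst measure_distr) (auto intro!: arg_cong[where f = prob])
    then show ?thesis
      unfolding p_def using id[of n] by simp
  qed
  have B_le: "prob (B K) \<le> p K" for K
  proof -
    let ?A = "\<lambda>n. {\<omega> \<in> space M. \<forall>k\<ge>n. ereal (real K) < Z k \<omega>}"
    have "(\<lambda>n. prob (?A n)) \<longlonglongrightarrow> prob (\<Union>n. ?A n)"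
      by (rule finite_Lim_measure_incseq) (auto simp: incseq_def)
    moreover have "prob (?A n) \<le> p K" for n
      unfolding marginal[of K n, symmetric] by (rule finite_measure_mono) auto
    ultimately show ?thesis
      unfolding B_def by (intro LIMSEQ_le_const2) auto
  qed
  \<comment> \<open>The tail events decrease to the event that \<open>Z 0\<close> is infinite, which
    is null by \<open>fin\<close>.\<close>
  have "p \<longlonglongrightarrow> prob (\<Inter>K. {\<omega> \<in> space M. ereal (real K) < Z 0 \<omega>})"
    unfolding p_def
    by (rule finite_Lim_measure_decseq) (auto simp: decseq_def elim!: le_less_trans[rotated])
  also have "(\<Inter>K. {\<omega> \<in> space M. ereal (real K) < Z 0 \<omega>}) = {\<omega> \<in> space M. Z 0 \<omega> = \<infinity>}"
  proof (intro set_eqI iffI)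
    fix \<omega> assume *: "\<omega> \<in> (\<Inter>K. {\<omega> \<in> space M. ereal (real K) < Z 0 \<omega>})"
    then have "Z 0 \<omega> = \<infinity>"
      using less_PInf_Ex_of_nat[of "Z 0 \<omega>"] by (auto dest: less_asym)
    then show "\<omega> \<in> {\<omega> \<in> space M. Z 0 \<omega> = \<infinity>}"
      using * by auto
  qed auto
  also have "prob \<dots> = 0"
    using fin by (subst prob_eq_0) auto
  finally have p0: "p \<longlonglongrightarrow> 0" .
  have "prob (\<Inter>K. B K) \<le> p K" for K
    using B_le[of K] by (intro order_trans[OF finite_measure_mono B_le]) auto
  then have "prob (\<Inter>K. B K) \<le> 0"
    using p0 by (intro LIMSEQ_le_const) auto
  then have "prob (\<Inter>K. B K) = 0"
    using measure_nonneg[of M "\<Inter>K. B K"] by linarith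
  then have "AE \<omega> in M. \<omega> \<notin> (\<Inter>K. B K)"
    by (subst (asm) prob_eq_0) auto
  with AE_space show ?thesis
  proof eventually_elim
    case (elim \<omega>)
    then show ?case
      by (auto simp: tendsto_PInfty B_def eventually_sequentially)
  qed
qed

section \<open>The recursion along a fixed trajectory\<close>

text \<open>Substituting \<open>l = j - i\<close> makes the sum run over naturals, so that one step
  of the recursion peels off the term \<open>i = 0\<close>.\<close>

lemma X_star_eq:
  "X_star s t j \<omega> = (SUP k. ereal (s (j - int k) \<omega> - (\<Sum>i<k. t (j - int i) \<omega>)))"
proof -
  have "(\<Sum>l = j - int k + 1..j. t l \<omega>) = (\<Sum>i<k. t (j - int i) \<omega>)" for k
    by (rule sum.reindex_bij_witness[of _ "\<lambda>i. j - int i" "\<lambda>l. nat (j - l)"]) auto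
  then show ?thesis
    by (simp add: X_star_def)
qed

lemma X_star_shift: "X_star s t (j + m) \<omega> = X_star (\<lambda>i. s (i + m)) (\<lambda>i. t (i + m)) j \<omega>"
  by (simp add: X_star_eq algebra_simps)

text \<open>Index \<open>j \<ge> 1\<close> on the left is index \<open>k = j - 1\<close> in the
  supremum at time \<open>- 1\<close>; this carries the finiteness assumption over to
  \<open>X_star\<close>.\<close>

lemma X_tilde_inf_eq: "X_tilde_inf s t \<omega> = max 0 (X_star s t (- 1) \<omega>)"
proof -
  have "(SUP j\<in>{1..}. ereal (s (- int j) \<omega> - (\<Sum>k = 1..j - 1. t (- int k) \<omega>))) =
        (SUP j\<in>range Suc. ereal (s (- int j) \<omega> - (\<Sum>k = 1..j - 1. t (- int k) \<omega>)))"
    by (rule SUP_cong) (auto simp: image_iff dest: Suc_le_D)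
  also have "\<dots> = X_star s t (- 1) \<omega>"
    unfolding X_star_eq image_image
    by (intro SUP_cong refl arg_cong[where f = ereal] arg_cong2[where f = "(-)"])
      (auto simp: algebra_simps intro!: sum.reindex_bij_witness[of _ Suc "\<lambda>k. k - 1"])
  finally show ?thesis
    by (simp add: X_tilde_inf_def)
qed

text \<open>The term \<open>k = 0\<close> is \<open>s (j + 1)\<close>; every later term is a term at
  time \<open>j\<close> minus the real \<open>t (j + 1)\<close>, which can be pulled out of the
  supremum. The identity is pointwise, infinite values included.\<close>

lemma X_star_rec:
  "X_star s t (j + 1) \<omega> = max (X_star s t j \<omega> - ereal (t (j + 1) \<omega>)) (ereal (s (j + 1) \<omega>))"
proof -
  let ?f = "\<lambda>k. ereal (s (j + 1 - int k) \<omega> - (\<Sum>i<k. t (j + 1 - int i) \<omega>))"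
  have f_Suc: "?f (Suc k) =
      ereal (s (j - int k) \<omega> - (\<Sum>i<k. t (j - int i) \<omega>)) - ereal (t (j + 1) \<omega>)" for k
    by (simp add: sum.lessThan_Suc_shift algebra_simps del: sum.lessThan_Suc)
  have "X_star s t (j + 1) \<omega> = (SUP k\<in>insert 0 (range Suc). ?f k)"
    unfolding X_star_eq by (simp add: UNIV_nat_eq[symmetric])
  also have "\<dots> = max (ereal (s (j + 1) \<omega>)) (SUP k. ?f (Suc k))"
    by (simp add: SUP_insert image_image sup_max)
  also have "(SUP k. ?f (Suc k)) = X_star s t j \<omega> - ereal (t (j + 1) \<omega>)"
    unfolding X_star_eq f_Suc by (rule SUP_ereal_minus_left) auto
  finally show ?thesis
    by (simp add: max.commute)
qed

lemma s_le_X_star: "ereal (s j \<omega>) \<le> X_star s t j \<omega>"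
  unfolding X_star_eq by (rule SUP_upper2[of 0]) auto

text \<open>As \<open>s_le_X_star\<close> excludes minus infinity, only plus infinity has to be
  tracked, and the recursion passes it on in both directions.\<close>

lemma X_star_finite_succ_iff:
  "\<bar>X_star s t (j + 1) \<omega>\<bar> \<noteq> \<infinity> \<longleftrightarrow> \<bar>X_star s t j \<omega>\<bar> \<noteq> \<infinity>"
  using s_le_X_star[of s j \<omega> t] unfolding X_star_rec
  by (cases "X_star s t j \<omega>") (auto simp: max_def)

lemma X_star_finite_iff: "\<bar>X_star s t i \<omega>\<bar> \<noteq> \<infinity> \<longleftrightarrow> \<bar>X_star s t j \<omega>\<bar> \<noteq> \<infinity>"
proof -
  have "\<bar>X_star s t i \<omega>\<bar> \<noteq> \<infinity> \<longleftrightarrow> \<bar>X_star s t 0 \<omega>\<bar> \<noteq> \<infinity>" for i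
  proof (induction i rule: int_induct[where k = 0])
    case (step2 i)
    then show ?case
      using X_star_finite_succ_iff[of s t "i - 1" \<omega>] by simp
  qed (simp_all add: X_star_finite_succ_iff)
  from this[of i] this[of j] show ?thesis
    by argo
qed

text \<open>Following the \<open>X\<close> side of the maximum \<open>k\<close> steps back and then
  taking the \<open>s\<close> side once bounds \<open>X j\<close> below by the \<open>k\<close>-th
  term of the supremum.\<close>

lemma solution_ge_X_star:
  assumes rec: "\<And>j. X (j + 1) = max (X j - ereal (t (j + 1) \<omega>)) (ereal (s (j + 1) \<omega>))"
  shows "X_star s t j \<omega> \<le> X j"
proof -
  have "ereal (s (j - int k) \<omega> - (\<Sum>i<k. t (j - int i) \<omega>)) \<le> X j" for k
  proof (induction k arbitrary: j)
    case 0
    then show ?case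
      using rec[of "j - 1"] by simp
  next
    case (Suc k)
    have "ereal (s (j - int (Suc k)) \<omega> - (\<Sum>i<Suc k. t (j - int i) \<omega>)) =
        ereal (s (j - 1 - int k) \<omega> - (\<Sum>i<k. t (j - 1 - int i) \<omega>)) - ereal (t j \<omega>)"
      by (simp add: sum.lessThan_Suc_shift algebra_simps del: sum.lessThan_Suc)
    also have "\<dots> \<le> X (j - 1) - ereal (t j \<omega>)"
      by (intro ereal_minus_mono Suc.IH) simp
    also have "\<dots> \<le> X j"
      using rec[of "j - 1"] by simp
    finally show ?case .
  qed
  then show ?thesis
    unfolding X_star_eq by (intro SUP_least)
qed

text \<open>Were \<open>s\<close> to attain the maximum for \<open>X\<close>, then \<open>X\<close>
  would be at most \<open>X_star\<close> there, against strictness. So the step merely subtracts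
  \<open>t\<close>, which can be undone, and strictness passes to the previous time.\<close>

lemma solution_gt_X_star_past:
  assumes rec: "\<And>j. X (j + 1) = max (X j - ereal (t (j + 1) \<omega>)) (ereal (s (j + 1) \<omega>))"
    and gt: "X_star s t j \<omega> < X j"
  shows "X (j - int k) = X j + ereal (\<Sum>i<k. t (j - int i) \<omega>) \<and>
    X_star s t (j - int k) \<omega> < X (j - int k)"
proof (induction k)
  case 0
  then show ?case
    using gt by (simp add: zero_ereal_def[symmetric])
next
  case (Suc k)
  let ?j = "j - int (Suc k)" and ?t = "t (j - int k) \<omega>"
  have j: "?j + 1 = j - int k"
    by simp
  have "X (j - int k) = max (X ?j - ereal ?t) (ereal (s (j - int k) \<omega>))"
    using rec[of ?j] unfolding j .
  moreover have "X_star s t (j - int k) \<omega> =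
      max (X_star s t ?j \<omega> - ereal ?t) (ereal (s (j - int k) \<omega>))"
    using X_star_rec[of s t ?j \<omega>] unfolding j .
  ultimately have eq: "X (j - int k) = X ?j - ereal ?t"
    and less: "X_star s t ?j \<omega> - ereal ?t < X ?j - ereal ?t"
    using Suc.IH by (auto simp: max_def split: if_splits)
  \<comment> \<open>\<open>?t\<close> is real, so the subtraction cancels even at infinite
    values.\<close>
  from eq have "X ?j = X (j - int k) + ereal ?t"
    by (cases "X ?j") auto
  with Suc.IH have "X ?j = X j + ereal (\<Sum>i<Suc k. t (j - int i) \<omega>)"
    by (cases "X j") auto
  moreover have "X_star s t ?j \<omega> < X ?j"
    using less by (cases "X ?j"; cases "X_star s t ?j \<omega>") auto
  ultimately show ?case
    by blast
qed

text \<open>Partial sums that do not diverge are bounded by monotonicity, so \<open>u\<close> is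
  summable and tends to \<open>0\<close>; positivity then makes the reciprocals diverge.\<close>

lemma partial_sums_at_top:
  fixes u :: "nat \<Rightarrow> real"
  assumes pos: "\<And>n. 0 < u n" and "\<not> (\<lambda>n. ereal (inverse (u n))) \<longlonglongrightarrow> \<infinity>"
  shows "filterlim (\<lambda>n. \<Sum>i<n. u i) at_top sequentially"
proof (rule ccontr)
  assume "\<not> ?thesis"
  then obtain K where K: "\<not> (\<forall>\<^sub>F n in sequentially. K \<le> (\<Sum>i<n. u i))"
    by (auto simp: filterlim_at_top)
  have "(\<Sum>i<n. u i) \<le> K" for n
  proof (rule ccontr)
    assume n: "\<not> ?thesis"
    \<comment> \<open>One partial sum above \<open>K\<close> would keep all later ones above
      \<open>K\<close>, contrary to the choice of \<open>K\<close>.\<close>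
    have "K \<le> (\<Sum>i<m. u i)" if "n \<le> m" for m
      using n sum_mono2[of "{..<m}" "{..<n}" u] that pos by (force intro: less_imp_le)
    with K show False
      by (auto simp: eventually_sequentially)
  qed
  then have "summable u"
    using pos by (intro summableI_nonneg_bounded[where x = K]) (auto intro: less_imp_le)
  then have "filterlim (\<lambda>n. inverse (u n)) at_top sequentially"
    using pos by (intro filterlim_inverse_at_top summable_LIMSEQ_zero) auto
  with assms(2) show False
    by (simp add: tendsto_PInfty_eq_at_top)
qed

text \<open>The probabilistic input is condensed into \<open>t\<close> and \<open>X\<close>: the
  first makes the backward sums diverge, the second forbids the solution to follow them.\<close>

lemma solution_eq_X_star:
  assumes rec: "\<And>j. X (j + 1) = max (X j - ereal (t (j + 1) \<omega>)) (ereal (s (j + 1) \<omega>))"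
    and pos: "\<And>j. 0 < t j \<omega>"
    and t: "\<not> (\<lambda>k. ereal (inverse (t (j - int k) \<omega>))) \<longlonglongrightarrow> \<infinity>"
    and X: "\<not> (\<lambda>k. X (j - int k)) \<longlonglongrightarrow> \<infinity>"
  shows "X j = X_star s t j \<omega>"
proof (rule ccontr)
  assume "X j \<noteq> X_star s t j \<omega>"
  then have gt: "X_star s t j \<omega> < X j"
    using solution_ge_X_star[of X t \<omega> s j, OF rec] by simp
  have "(\<lambda>k. ereal (\<Sum>i<k. t (j - int i) \<omega>)) \<longlonglongrightarrow> \<infinity>"
    using partial_sums_at_top[of "\<lambda>k. t (j - int k) \<omega>"] pos t
    by (simp add: tendsto_PInfty_eq_at_top)
  \<comment> \<open>Excludes the indeterminate sum of minus and plus infinity in the limit.\<close>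
  moreover have "X j \<noteq> - \<infinity>"
    using gt by auto
  ultimately have "(\<lambda>k. X j + ereal (\<Sum>i<k. t (j - int i) \<omega>)) \<longlonglongrightarrow> X j + \<infinity>"
    by (intro tendsto_add_ereal_general tendsto_const) auto
  with X gt show False
    using solution_gt_X_star_past[of X t \<omega> s j, OF rec gt] by simp
qed

section \<open>Existence and uniqueness of the stationary solution\<close>

text \<open>Here \<open>X_star\<close> is a function on the space of trajectories, with
  \<open>y i\<close> read as the pair of \<open>s i\<close> and \<open>t i\<close>, the form in
  which \<open>stationary_sequence_factor\<close> takes it.\<close>

lemma X_star_measurable_PiM:
  "(\<lambda>y. X_star (\<lambda>i y. fst (y i)) (\<lambda>i y. snd (y i)) j y)
    \<in> borel_measurable (Pi\<^sub>M UNIV (\<lambda>_. borel \<Otimes>\<^sub>M borel))"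
  unfolding X_star_eq by measurable

lemma stationary_sequence_X_star:
  assumes "stationary_sequence M (borel \<Otimes>\<^sub>M borel) (\<lambda>j \<omega>. (s j \<omega>, t j \<omega>))"
  shows "stationary_sequence M (borel \<Otimes>\<^sub>M borel \<Otimes>\<^sub>M borel)
      (\<lambda>j \<omega>. (s j \<omega>, t j \<omega>, X_star s t j \<omega>))"
    and "stationary_sequence M borel (X_star s t)"
proof -
  let ?X = "\<lambda>y. X_star (\<lambda>i y. fst (y i)) (\<lambda>i y. snd (y i)) 0 y"
  have [measurable]: "?X \<in> borel_measurable (Pi\<^sub>M UNIV (\<lambda>_. borel \<Otimes>\<^sub>M borel))"
    by (rule X_star_measurable_PiM)
  \<comment> \<open>The functional for time \<open>0\<close>, evaluated on the shifted trajectory,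
    gives the value at time \<open>j\<close>.\<close>
  have X: "?X (\<lambda>i. (s (i + j) \<omega>, t (i + j) \<omega>)) = X_star s t j \<omega>" for j \<omega>
    using X_star_shift[of s t 0 j \<omega>] by (simp add: X_star_eq)
  have "(\<lambda>y. (fst (y 0), snd (y 0), ?X y)) \<in>
      measurable (Pi\<^sub>M UNIV (\<lambda>_. borel \<Otimes>\<^sub>M borel)) (borel \<Otimes>\<^sub>M borel \<Otimes>\<^sub>M borel)"
    by measurable
  from stationary_sequence_factor[OF assms this]
  show "stationary_sequence M (borel \<Otimes>\<^sub>M borel \<Otimes>\<^sub>M borel)
      (\<lambda>j \<omega>. (s j \<omega>, t j \<omega>, X_star s t j \<omega>))"
    by (simp add: X)
  from stationary_sequence_factor[OF assms X_star_measurable_PiM[of 0]]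
  show "stationary_sequence M borel (X_star s t)"
    by (simp add: X)
qed

text \<open>The null sets of the individual times are merged by countability, so that the trajectory
  argument applies to almost every \<omega>.\<close>

lemma (in prob_space) stationary_solution_unique:
  assumes st: "stationary_sequence M (borel \<Otimes>\<^sub>M borel) (\<lambda>j \<omega>. (s j \<omega>, t j \<omega>))"
    and pos: "\<And>j. AE \<omega> in M. 0 < t j \<omega>"
    and X: "stationary_solution M s t X"
  shows "AE \<omega> in M. X j \<omega> = X_star s t j \<omega>"
proof -
  have X_stat: "stationary_sequence M borel X"
    and X_fin: "\<And>j. AE \<omega> in M. \<bar>X j \<omega>\<bar> \<noteq> \<infinity>"
    and X_rec: "\<And>j. AE \<omega> in M. X (j + 1) \<omega> =
      max (X j \<omega> - ereal (t (j + 1) \<omega>)) (ereal (s (j + 1) \<omega>))"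
    using X by (auto simp: stationary_solution_def)
  \<comment> \<open>The reciprocals are real, so their embedding is never infinite and the
    finiteness premise of \<open>AE_not_tendsto_PInfty\<close> is immediate.\<close>
  have inv: "stationary_sequence M borel (\<lambda>j \<omega>. ereal (inverse (t j \<omega>)))"
    using stationary_sequence_factor[OF st, of "\<lambda>y. ereal (inverse (snd (y 0)))" borel] by simp
  have "AE \<omega> in M. \<not> (\<lambda>k. X (j - int k) \<omega>) \<longlonglongrightarrow> \<infinity>"
  proof (rule AE_not_tendsto_PInfty)
    show "AE \<omega> in M. X (j - int 0) \<omega> \<noteq> \<infinity>"
      using X_fin[of "j - int 0"] by eventually_elim auto
  qed (auto intro: stationary_sequence_measurable[OF X_stat] stationary_sequence_distr_eq[OF X_stat])
  moreover have "AE \<omega> in M. \<not> (\<lambda>k. ereal (inverse (t (j - int k) \<omega>))) \<longlonglongrightarrow> \<infinity>"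
    by (rule AE_not_tendsto_PInfty)
      (auto intro: stationary_sequence_measurable[OF inv] stationary_sequence_distr_eq[OF inv])
  moreover have "AE \<omega> in M. \<forall>j. 0 < t j \<omega>"
    using pos by (simp add: AE_all_countable)
  moreover have "AE \<omega> in M. \<forall>j. X (j + 1) \<omega> =
      max (X j \<omega> - ereal (t (j + 1) \<omega>)) (ereal (s (j + 1) \<omega>))"
    using X_rec by (simp add: AE_all_countable)
  ultimately show ?thesis
  proof eventually_elim
    case (elim \<omega>)
    then show ?case
      by (intro solution_eq_X_star[where X = "\<lambda>j. X j \<omega>"]) auto
  qed
qed

theorem theorem1:
  fixes M :: "'a measure" and s t :: "int \<Rightarrow> 'a \<Rightarrow> real"
  assumes "prob_space M"
    and "stationary_ergodic_sequence M (borel \<Otimes>\<^sub>M borel) (\<lambda>j \<omega>. (s j \<omega>, t j \<omega>))"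
    and "\<And>j. AE \<omega> in M. 0 < s j \<omega> \<and> 0 < t j \<omega>"
    and "AE \<omega> in M. \<bar>X_tilde_inf s t \<omega>\<bar> \<noteq> \<infinity>"
  shows "(stationary_sequence M (borel \<Otimes>\<^sub>M borel \<Otimes>\<^sub>M borel)
            (\<lambda>j \<omega>. (s j \<omega>, t j \<omega>, X_star s t j \<omega>)) \<and>
          (\<forall>j. \<forall>\<omega> \<in> space M.
             X_star s t (j + 1) \<omega> =
               max (X_star s t j \<omega> - ereal (t (j + 1) \<omega>)) (ereal (s (j + 1) \<omega>))) \<and>
          stationary_solution M s t (X_star s t)) \<and>
         (\<forall>X'. stationary_solution M s t X' \<longrightarrow>
            (\<forall>j. AE \<omega> in M. X' j \<omega> = X_star s t j \<omega>))"
proof -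
  interpret prob_space M by fact
  have st: "stationary_sequence M (borel \<Otimes>\<^sub>M borel) (\<lambda>j \<omega>. (s j \<omega>, t j \<omega>))"
    using assms(2) by (simp add: stationary_ergodic_sequence_def)
  have fin: "AE \<omega> in M. \<bar>X_star s t j \<omega>\<bar> \<noteq> \<infinity>" for j
    using assms(4)
  proof eventually_elim
    case (elim \<omega>)
    \<comment> \<open>The maximum with \<open>0\<close> would hide the value minus infinity, which
      the lower bound by \<open>s\<close> rules out.\<close>
    then have "\<bar>X_star s t (- 1) \<omega>\<bar> \<noteq> \<infinity>"
      using s_le_X_star[of s "- 1" \<omega> t] unfolding X_tilde_inf_eq
      by (cases "X_star s t (- 1) \<omega>") auto
    then show ?case
      by (simp add: X_star_finite_iff[of s t j \<omega> "- 1"])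
  qed
  have pos: "AE \<omega> in M. 0 < t j \<omega>" for j
    using assms(3)[of j] by eventually_elim simp
  have "stationary_solution M s t (X_star s t)"
    unfolding stationary_solution_def
    using stationary_sequence_X_star(2)[OF st] fin by (simp add: X_star_rec)
  then show ?thesis
    using stationary_sequence_X_star(1)[OF st] X_star_rec stationary_solution_unique[OF st pos]
    by (intro conjI allI impI ballI)
qed

end
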